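(* Let $X$ be a real random variable with finite law $\mathbb P(X=x_i)=p_i>0$, $1\le i\le n$, $\sum_{i=1}^n p_i=1$, $n\ge2$, supported on a lattice: $x_i=x_1+(i-1)h$ with $h>0$. Suppose that both sequences $(P_i)_{1\le i\le n}$ and $(T_i)_{1\le i\le n}$ are log-concave, where $P_i=\sum_{j\le i}p_j$ and $T_i=\sum_{j\ge i}p_j$. Then, with the notation of the context, $(R_i)_{1\le i\le n}$ is strictly decreasing and $(L_i)_{1\le i\le n}$ is strictly increasing. In particular, the probability-coordinate risk profile (the polygon through the points $(P_i,W_i)$, $0\le i\le n$) has strictly increasing consecutive slopes $(W_i-W_{i-1})/p_i$. The optimal cut (the index $i$, $1\le i<n$, minimizing $W_i$) is unique, apart from a possible tie between two adjacent cuts.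
   Context: A positive sequence $(s_i)$ is log-concave if $s_i^2\ge s_{i-1}s_{i+1}$ whenever the three terms occur. Put $P_0:=0$. For $1\le i<n$ the optimized squared risk at the cut after $x_i$ is $$W_i:=\min_{a,b\in\mathbb R}\Big\{\sum_{j\le i}p_j(x_j-a)^2+\sum_{j>i}p_j(x_j-b)^2\Big\},$$ and $W_0=W_n:=\operatorname{Var}(X)$. For $1\le i<n$ set $A_i:=\sum_{j>i}p_j(x_j-x_i)$ and $R_i:=A_i/\sqrt{T_iT_{i+1}}$; for $1<i\le n$ set $C_i:=\sum_{j<i}p_j(x_i-x_j)$ and $L_i:=C_i/\sqrt{P_{i-1}P_i}$; and $L_1:=0$, $R_n:=0$. *)

theory Defs
  imports "HOL-Probability.Probability"
begin

text \<open>
  Throughout, a finite law is given by its atoms \<open>x 1, \<dots>, x n\<close> and their masses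
  \<open>p 1, \<dots>, p n\<close>; the values of \<open>x\<close> and \<open>p\<close> at other indices are irrelevant.
\<close>

definition log_concave_seq :: "(nat \<Rightarrow> real) \<Rightarrow> nat \<Rightarrow> bool" where
  "log_concave_seq s n \<longleftrightarrow>
     (\<forall>i\<in>{1..n}. 0 < s i) \<and> (\<forall>i. 1 < i \<and> i < n \<longrightarrow> s (i - 1) * s (i + 1) \<le> (s i)\<^sup>2)"

definition lower_mass :: "(nat \<Rightarrow> real) \<Rightarrow> nat \<Rightarrow> real" where
  "lower_mass p i = (\<Sum>j\<in>{1..i}. p j)"

definition upper_mass :: "(nat \<Rightarrow> real) \<Rightarrow> nat \<Rightarrow> nat \<Rightarrow> real" where
  "upper_mass p n i = (\<Sum>j\<in>{i..n}. p j)"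

definition upper_excess :: "(nat \<Rightarrow> real) \<Rightarrow> (nat \<Rightarrow> real) \<Rightarrow> nat \<Rightarrow> nat \<Rightarrow> real" where
  "upper_excess x p n i = (\<Sum>j\<in>{i<..n}. p j * (x j - x i))"

definition lower_excess :: "(nat \<Rightarrow> real) \<Rightarrow> (nat \<Rightarrow> real) \<Rightarrow> nat \<Rightarrow> real" where
  "lower_excess x p i = (\<Sum>j\<in>{1..<i}. p j * (x i - x j))"

definition right_ratio :: "(nat \<Rightarrow> real) \<Rightarrow> (nat \<Rightarrow> real) \<Rightarrow> nat \<Rightarrow> nat \<Rightarrow> real" where
  "right_ratio x p n i =
     (if 1 \<le> i \<and> i < n
      then upper_excess x p n i / sqrt (upper_mass p n i * upper_mass p n (i + 1)) else 0)"

definition left_ratio :: "(nat \<Rightarrow> real) \<Rightarrow> (nat \<Rightarrow> real) \<Rightarrow> nat \<Rightarrow> nat \<Rightarrow> real" where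
  "left_ratio x p n i =
     (if 1 < i \<and> i \<le> n
      then lower_excess x p i / sqrt (lower_mass p (i - 1) * lower_mass p i) else 0)"

text \<open>
  The endpoint values are variances, so the risk depends on the random variable as well as on
  the description \<open>x\<close>, \<open>p\<close> of its law. Taking \<open>LEAST\<close> of the attained values is a genuine
  minimum: its defining property is available only once the minimum is shown to be attained.
\<close>
definition cut_risk ::
    "'a measure \<Rightarrow> ('a \<Rightarrow> real) \<Rightarrow> (nat \<Rightarrow> real) \<Rightarrow> (nat \<Rightarrow> real) \<Rightarrow> nat \<Rightarrow> nat \<Rightarrow> real" where
  "cut_risk M X x p n i =
     (if 1 \<le> i \<and> i < n
      then (LEAST v. \<exists>a b. v = (\<Sum>j\<in>{1..i}. p j * (x j - a)\<^sup>2) + (\<Sum>j\<in>{i<..n}. p j * (x j - b)\<^sup>2))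
      else prob_space.variance M X)"

end

theory Submission imports Defs begin

text \<open>
  Abel summation on the lattice gives \<open>C\<^sub>i = h * (P\<^sub>1 + \<dots> + P\<^sub>i\<^sub>-\<^sub>1)\<close>. Writing \<open>S\<^sub>i\<close> for this partial sum,
  log-concavity of \<open>P\<close> makes both \<open>S\<^sub>i / P\<^sub>i\<close> and \<open>S\<^sub>i / P\<^sub>i\<^sub>-\<^sub>1\<close> strictly increasing, hence also
  their geometric mean \<open>L\<^sub>i / h\<close>; the statement on \<open>R\<close> is the same one for the law of \<open>-X\<close>.
  The between-group variance at the cut after \<open>x\<^sub>i\<close> is
  \<open>(P\<^sub>i A\<^sub>i + T\<^sub>i\<^sub>+\<^sub>1 C\<^sub>i)\<^sup>2 / (P\<^sub>i T\<^sub>i\<^sub>+\<^sub>1)\<close>, at the preceding cut it is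
  \<open>(P\<^sub>i\<^sub>-\<^sub>1 A\<^sub>i + T\<^sub>i C\<^sub>i)\<^sup>2 / (P\<^sub>i\<^sub>-\<^sub>1 T\<^sub>i)\<close>, and the difference of the two collapses to
  \<open>p\<^sub>i (R\<^sub>i\<^sup>2 - L\<^sub>i\<^sup>2)\<close>. So the slopes \<open>L\<^sub>i\<^sup>2 - R\<^sub>i\<^sup>2\<close> increase strictly.
\<close>

section \<open>Partial sums of log-concave sequences\<close>

lemma strict_mono_on_atLeastAtMost_SucI:
  fixes f :: "nat \<Rightarrow> real"
  assumes "\<And>i. m \<le> i \<Longrightarrow> i < n \<Longrightarrow> f i < f (Suc i)"
  shows "strict_mono_on {m..n} f"
proof (rule strict_mono_onI)
  fix r s assume rs: "r \<in> {m..n}" "s \<in> {m..n}" "r < s"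
  have "Suc r \<le> t \<Longrightarrow> t \<le> n \<Longrightarrow> f r < f t" for t
  proof (induction t rule: dec_induct)
    case base
    then show ?case using assms[of r] rs by auto
  next
    case (step t)
    then show ?case using assms[of t] rs by fastforce
  qed
  then show "f r < f s" using rs by auto
qed

text \<open>Appending one term to both sums preserves the inequality, because log-concavity compares
  the two appended products. Log-concavity is only a weak inequality: strictness comes from
  \<open>i = 1\<close>, where the left sum is empty and the right one is
  \<open>u 1 > 0\<close>.\<close>

lemma log_concave_partial_sum_ratio_less:
  assumes lc: "log_concave_seq u n" and "1 \<le> i" "i < n"
  shows "(\<Sum>k\<in>{1..<i}. u k) * u (Suc i) < (\<Sum>k\<in>{1..<Suc i}. u k) * u i"
  using \<open>1 \<le> i\<close> \<open>i < n\<close>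
proof (induction i rule: dec_induct)
  case base
  then show ?case using lc by (auto simp: log_concave_seq_def)
next
  case (step i)
  let ?S = "\<lambda>i. \<Sum>k\<in>{1..<i}. u k"
  have pos: "0 < u i" "0 < u (Suc i)" "0 < u (Suc (Suc i))"
    using lc step by (auto simp: log_concave_seq_def)
  have lci: "u i * u (Suc (Suc i)) \<le> (u (Suc i))\<^sup>2"
    using lc step.hyps step.prems unfolding log_concave_seq_def
    by (auto dest!: spec[of _ "Suc i"])
  have S: "?S (Suc i) = ?S i + u i" "?S (Suc (Suc i)) = ?S (Suc i) + u (Suc i)"
    using step.hyps by (auto simp: sum.atLeastLessThan_Suc)
  have IH: "?S i * u (Suc i) < ?S (Suc i) * u i" using step by simp
  have S0: "0 \<le> ?S i"
    using lc step by (intro sum_nonneg) (auto simp: log_concave_seq_def intro: less_imp_le)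
  \<comment> \<open>The factor \<open>u i\<close> is inserted so that log-concavity applies to
    \<open>u i * u (Suc (Suc i))\<close>; it is cancelled afterwards.\<close>
  have "?S i * u (Suc (Suc i)) * u i \<le> ?S i * (u (Suc i))\<^sup>2"
    using mult_left_mono[OF lci S0] by (simp add: mult_ac)
  also have "\<dots> = ?S i * u (Suc i) * u (Suc i)" by (simp add: power2_eq_square)
  also have "\<dots> < ?S (Suc i) * u i * u (Suc i)"
    using IH pos by simp
  finally have "?S i * u (Suc (Suc i)) * u i < ?S (Suc i) * u (Suc i) * u i"
    by (simp add: mult_ac)
  then have "?S i * u (Suc (Suc i)) < ?S (Suc i) * u (Suc i)"
    using pos by simp
  then have "(?S i + u i) * u (Suc (Suc i)) < (?S (Suc i) + u (Suc i)) * u (Suc i)"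
    using lci by (simp add: distrib_right power2_eq_square)
  then show ?case unfolding S(2) by (simp only: S(1))
qed

lemma log_concave_partial_sum_strict_mono:
  assumes lc: "log_concave_seq u n"
  shows "strict_mono_on {1..n} (\<lambda>i. (\<Sum>k\<in>{1..<i}. u k) / sqrt (u (i - 1) * u i))"
proof (rule strict_mono_on_atLeastAtMost_SucI)
  fix i assume i: "1 \<le> i" "i < n"
  let ?S = "\<lambda>i. \<Sum>k\<in>{1..<i}. u k"
  have u: "0 < u k" if "k \<in> {1..n}" for k
    using lc that by (auto simp: log_concave_seq_def)
  have S0: "0 \<le> ?S j" if "j \<le> n" for j
    using u that by (intro sum_nonneg) (auto intro: less_imp_le)
  show "?S i / sqrt (u (i - 1) * u i) < ?S (Suc i) / sqrt (u (Suc i - 1) * u (Suc i))"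
  proof (cases "i = 1")
    case True
    \<comment> \<open>Nothing is known about \<open>u 0\<close>; the left side is \<open>0\<close>
      for any value of it, since the sum is empty.\<close>
    then show ?thesis using u[of 1] u[of 2] i by (simp add: numeral_2_eq_2)
  next
    case False
    then obtain m where m: "i = Suc m" "1 \<le> m" using i by (cases i) auto
    have pos: "0 < u m" "0 < u (Suc m)" "0 < u (Suc (Suc m))"
      using u i m by auto
    have S: "?S (Suc m) = ?S m + u m" "?S (Suc (Suc m)) = ?S (Suc m) + u (Suc m)"
      using m by (auto simp: sum.atLeastLessThan_Suc)
    have one: "?S (Suc m) * u (Suc (Suc m)) < ?S (Suc (Suc m)) * u (Suc m)"
      using log_concave_partial_sum_ratio_less[OF lc, of "Suc m"] i m by simp
    \<comment> \<open>Since \<open>?S (Suc m) / u m = ?S m / u m + 1\<close>, monotonicity of the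
      second ratio is that of the first, one index earlier.\<close>
    have "?S m * u (Suc m) < ?S (Suc m) * u m"
      using log_concave_partial_sum_ratio_less[OF lc, of m] i m by simp
    then have two: "?S (Suc m) * u (Suc m) < ?S (Suc (Suc m)) * u m"
      unfolding S(2) using m by (simp add: algebra_simps)
    \<comment> \<open>The product of the two inequalities compares the squared quotients, once the
      common factor \<open>u (Suc m)\<close> is cancelled.\<close>
    have "(?S (Suc m) * u (Suc (Suc m))) * (?S (Suc m) * u (Suc m))
        < (?S (Suc (Suc m)) * u (Suc m)) * (?S (Suc (Suc m)) * u m)"
      using pos S0[of "Suc m"] i m
      by (intro mult_strict_mono'[OF one two] mult_nonneg_nonneg) auto
    then have "((?S (Suc m))\<^sup>2 * u (Suc (Suc m))) * u (Suc m)
        < ((?S (Suc (Suc m)))\<^sup>2 * u m) * u (Suc m)"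
      by (simp add: power2_eq_square mult_ac)
    then have sq: "(?S (Suc m))\<^sup>2 * u (Suc (Suc m)) < (?S (Suc (Suc m)))\<^sup>2 * u m"
      using pos by simp
    have "(?S (Suc m) / sqrt (u m * u (Suc m)))\<^sup>2
        < (?S (Suc (Suc m)) / sqrt (u (Suc m) * u (Suc (Suc m))))\<^sup>2"
      using sq pos by (simp add: power_divide field_simps)
    then show ?thesis
      using S0[of "Suc (Suc m)"] pos i m by (auto dest!: power2_less_imp_less)
  qed
qed

section \<open>The ratios on a lattice\<close>

text \<open>Each lattice step of the reference point to the right adds \<open>h\<close> to its
  distance from every atom left behind, hence \<open>h\<close> times their total mass.\<close>

lemma lower_excess_lattice:
  assumes "\<And>j. j \<in> {1..n} \<Longrightarrow> x j = x 1 + (real j - 1) * h" and "1 \<le> i" "i \<le> n"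
  shows "lower_excess x p i = h * (\<Sum>k\<in>{1..<i}. lower_mass p k)"
  using \<open>1 \<le> i\<close> \<open>i \<le> n\<close>
proof (induction i rule: dec_induct)
  case base
  then show ?case by (simp add: lower_excess_def)
next
  case (step i)
  have "x (Suc i) - x i = h"
    using assms(1)[of i] assms(1)[of "Suc i"] step by (simp add: algebra_simps)
  then have "p j * (x (Suc i) - x j) = p j * (x i - x j) + h * p j" for j
    by (simp add: algebra_simps)
  \<comment> \<open>The range now contains \<open>j = i\<close>, but that summand is
    \<open>0\<close>, so the sum is still \<open>lower_excess x p i\<close>.\<close>
  then have "lower_excess x p (Suc i) = (\<Sum>j\<in>{1..<Suc i}. p j * (x i - x j)) + h * lower_mass p i"
    by (simp add: lower_excess_def lower_mass_def sum.distrib sum_distrib_left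
        atLeastLessThanSuc_atLeastAtMost del: sum.op_ivl_Suc)
  then show ?case
    using step by (simp add: lower_excess_def algebra_simps)
qed

lemma left_ratio_strict_mono:
  assumes "\<And>j. j \<in> {1..n} \<Longrightarrow> x j = x 1 + (real j - 1) * h" and "h > 0"
    and lc: "log_concave_seq (lower_mass p) n"
  shows "strict_mono_on {1..n} (left_ratio x p n)"
proof -
  \<comment> \<open>At \<open>i = 1\<close> the root is \<open>0\<close>, but the sum is empty, in
    agreement with the convention for \<open>left_ratio\<close>.\<close>
  have eq: "left_ratio x p n i
      = h * ((\<Sum>k\<in>{1..<i}. lower_mass p k) / sqrt (lower_mass p (i - 1) * lower_mass p i))"
    if "i \<in> {1..n}" for i
  proof (cases "i = 1")
    case False
    then show ?thesis
      using that lower_excess_lattice[OF assms(1), where i = i and p = p] by (auto simp: left_ratio_def)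
  qed (simp add: left_ratio_def)
  show ?thesis
    using log_concave_partial_sum_strict_mono[OF lc] \<open>h > 0\<close>
    by (auto simp: strict_mono_on_def eq simp del: times_divide_eq_right)
qed

section \<open>Reflection: exchanging lower and upper quantities\<close>

lemma sum_atLeastAtMost_reflect:
  fixes f :: "nat \<Rightarrow> 'b::comm_monoid_add"
  assumes "1 \<le> a" "a \<le> n"
  shows "(\<Sum>j\<in>{a..n}. f j) = (\<Sum>j\<in>{1..n + 1 - a}. f (n + 1 - j))"
  using assms
  by (intro sum.reindex_bij_witness[of _ "\<lambda>j. n + 1 - j" "\<lambda>j. n + 1 - j"]) auto

lemma upper_mass_reflect:
  assumes "1 \<le> i" "i \<le> n"
  shows "upper_mass p n i = lower_mass (\<lambda>j. p (n + 1 - j)) (n + 1 - i)"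
  using sum_atLeastAtMost_reflect[OF assms, of p]
  by (simp add: upper_mass_def lower_mass_def)

text \<open>Negating the atoms and reversing their order describes the law of \<open>-X\<close> with
  increasing atoms; this turns upper tails into lower ones.\<close>

lemma right_ratio_reflect:
  assumes "i \<in> {1..n}"
  shows "right_ratio x p n i
    = left_ratio (\<lambda>j. - x (n + 1 - j)) (\<lambda>j. p (n + 1 - j)) n (n + 1 - i)"
proof (cases "i = n")
  case True
  then show ?thesis by (simp add: right_ratio_def left_ratio_def)
next
  case False
  then have i: "1 \<le> i" "i < n" using assms by auto
  have sets: "{i<..n} = {i + 1..n}" "{1..<n + 1 - i} = {1..n + 1 - (i + 1)}" by auto
  have "upper_excess x p n i
      = lower_excess (\<lambda>j. - x (n + 1 - j)) (\<lambda>j. p (n + 1 - j)) (n + 1 - i)"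
    unfolding upper_excess_def lower_excess_def sets
    using sum_atLeastAtMost_reflect[of "i + 1" n "\<lambda>j. p j * (x j - x i)"] i by simp
  moreover have "1 < n + 1 - i" "n + 1 - i \<le> n" "n + 1 - i - 1 = n + 1 - (i + 1)"
    using i by auto
  ultimately show ?thesis
    using i upper_mass_reflect[of i n p] upper_mass_reflect[of "i + 1" n p]
    by (simp add: right_ratio_def left_ratio_def mult.commute)
qed

lemma log_concave_seq_reflect:
  assumes "log_concave_seq s n"
  shows "log_concave_seq (\<lambda>i. s (n + 1 - i)) n"
  unfolding log_concave_seq_def
proof (intro conjI ballI allI impI)
  fix i assume "i \<in> {1..n}"
  then have "n + 1 - i \<in> {1..n}" by auto
  then show "0 < s (n + 1 - i)" using assms unfolding log_concave_seq_def by blast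
next
  fix i assume i: "1 < i \<and> i < n"
  have "n + 1 - (i - 1) = n + 1 - i + 1" "n + 1 - (i + 1) = n + 1 - i - 1" using i by auto
  moreover have "s (n + 1 - i - 1) * s (n + 1 - i + 1) \<le> (s (n + 1 - i))\<^sup>2"
    using assms i unfolding log_concave_seq_def by (auto dest!: spec[of _ "n + 1 - i"])
  ultimately show "s (n + 1 - (i - 1)) * s (n + 1 - (i + 1)) \<le> (s (n + 1 - i))\<^sup>2"
    by (simp only: mult.commute)
qed

text \<open>The neighbours of an interior index stay in \<open>{1..n}\<close>. This allows reflected
  upper masses to be replaced by lower masses, an identity established on that range only.\<close>

lemma log_concave_seq_cong:
  assumes "\<And>i. i \<in> {1..n} \<Longrightarrow> s i = t i"
  shows "log_concave_seq s n \<longleftrightarrow> log_concave_seq t n"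
proof -
  have "s (i - 1) = t (i - 1)" "s (i + 1) = t (i + 1)" if "1 < i" "i < n" for i
  proof -
    have "i - 1 \<in> {1..n}" "i + 1 \<in> {1..n}" using that by auto
    then show "s (i - 1) = t (i - 1)" "s (i + 1) = t (i + 1)"
      using assms by blast+
  qed
  then show ?thesis using assms by (auto simp: log_concave_seq_def)
qed

text \<open>The reflected law again lives on a lattice of step \<open>h\<close>, and its lower
  masses are the reversed upper masses. Undoing the reversal turns increase into decrease.\<close>

lemma right_ratio_strict_antimono:
  assumes x: "\<And>j. j \<in> {1..n} \<Longrightarrow> x j = x 1 + (real j - 1) * h" and "h > 0"
    and lc: "log_concave_seq (upper_mass p n) n"
  shows "strict_antimono_on {1..n} (right_ratio x p n)"
proof -
  let ?x = "\<lambda>j. - x (n + 1 - j)" and ?p = "\<lambda>j. p (n + 1 - j)"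
  have "?x j = ?x 1 + (real j - 1) * h" if "j \<in> {1..n}" for j
  proof -
    have "n + 1 - j \<in> {1..n}" "n \<in> {1..n}" "real (n + 1 - j) = real n + 1 - real j"
      using that by auto
    then show ?thesis using x[of "n + 1 - j"] x[of n] by (simp add: algebra_simps)
  qed
  moreover have "log_concave_seq (lower_mass ?p) n"
  proof -
    have eq: "upper_mass p n (n + 1 - i) = lower_mass ?p i" if "i \<in> {1..n}" for i
    proof -
      have "1 \<le> n + 1 - i" "n + 1 - i \<le> n" "n + 1 - (n + 1 - i) = i" using that by auto
      then show ?thesis using upper_mass_reflect[of "n + 1 - i" n p] by metis
    qed
    then show ?thesis
      using log_concave_seq_reflect[OF lc] log_concave_seq_cong[OF eq] by simp
  qed
  ultimately have mono: "strict_mono_on {1..n} (left_ratio ?x ?p n)"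
    using \<open>h > 0\<close> by (intro left_ratio_strict_mono[of n ?x h ?p]) auto
  show ?thesis
  proof (rule monotone_onI)
    fix r s assume rs: "r \<in> {1..n}" "s \<in> {1..n}" "r < s"
    then have "n + 1 - s \<in> {1..n}" "n + 1 - r \<in> {1..n}" "n + 1 - s < n + 1 - r" by auto
    then have "left_ratio ?x ?p n (n + 1 - s) < left_ratio ?x ?p n (n + 1 - r)"
      by (rule strict_mono_onD[OF mono])
    then show "right_ratio x p n r > right_ratio x p n s"
      using rs by (simp only: right_ratio_reflect)
  qed
qed

section \<open>Variance and cut risk\<close>

text \<open>The events \<open>X = x i\<close> are disjoint by injectivity and have total probability
  \<open>1\<close>, so \<open>f (X \<omega>)\<close> agrees almost everywhere with a finite sum of
  indicators.\<close>

lemma (in prob_space) expectation_finite_law: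
  fixes X :: "'a \<Rightarrow> real" and f :: "real \<Rightarrow> real"
  assumes X: "X \<in> borel_measurable M" and "finite I" and inj: "inj_on x I"
    and p: "\<And>i. i \<in> I \<Longrightarrow> \<P>(\<omega> in M. X \<omega> = x i) = p i" and sum: "(\<Sum>i\<in>I. p i) = 1"
    and f: "f \<in> borel_measurable borel"
  shows "expectation (\<lambda>\<omega>. f (X \<omega>)) = (\<Sum>i\<in>I. p i * f (x i))"
proof -
  let ?E = "\<lambda>i. {\<omega> \<in> space M. X \<omega> = x i}"
  note [measurable] = X f
  have E [measurable]: "?E i \<in> sets M" for i by measurable
  have "prob (\<Union>i\<in>I. ?E i) = (\<Sum>i\<in>I. prob (?E i))"
    using \<open>finite I\<close> inj E
    by (intro finite_measure_finite_Union) (auto simp: disjoint_family_on_def inj_on_def)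
  also have "\<dots> = 1" using p sum by simp
  finally have "AE \<omega> in M. \<omega> \<in> (\<Union>i\<in>I. ?E i)"
    using \<open>finite I\<close> E by (subst (asm) prob_eq_1) (auto intro!: sets.finite_UN)
  then have "AE \<omega> in M. f (X \<omega>) = (\<Sum>i\<in>I. f (x i) * indicator (?E i) \<omega>)"
  proof eventually_elim
    case (elim \<omega>)
    then obtain i where i: "i \<in> I" "\<omega> \<in> ?E i" by blast
    have "(\<Sum>j\<in>I. f (x j) * indicator (?E j) \<omega>) = (\<Sum>j\<in>I. if j = i then f (x j) else 0)"
      using i inj by (intro sum.cong) (auto simp: inj_on_def indicator_def)
    then show ?case using i \<open>finite I\<close> by simp
  qed
  then have "expectation (\<lambda>\<omega>. f (X \<omega>)) = expectation (\<lambda>\<omega>. \<Sum>i\<in>I. f (x i) * indicator (?E i) \<omega>)"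
    by (intro integral_cong_AE) auto
  also have "\<dots> = (\<Sum>i\<in>I. f (x i) * prob (?E i))"
    by (subst Bochner_Integration.integral_sum)
      (auto simp: integrable_real_mult_indicator emeasure_eq_measure)
  finally show ?thesis using p by (simp add: mult.commute)
qed

text \<open>Completing the square in \<open>a\<close> around the weighted mean. This gives both the
  variance formula and the optimal constant on each side of a cut.\<close>

lemma sum_weighted_square_shift:
  fixes p x :: "'b \<Rightarrow> real"
  assumes "sum p J \<noteq> 0"
  shows "(\<Sum>j\<in>J. p j * (x j - a)\<^sup>2)
    = (\<Sum>j\<in>J. p j * (x j)\<^sup>2) - (\<Sum>j\<in>J. p j * x j)\<^sup>2 / sum p J
      + sum p J * (a - (\<Sum>j\<in>J. p j * x j) / sum p J)\<^sup>2"
proof -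
  have "(\<Sum>j\<in>J. p j * (x j - a)\<^sup>2)
      = (\<Sum>j\<in>J. p j * (x j)\<^sup>2 - 2 * a * (p j * x j) + a\<^sup>2 * p j)"
    by (intro sum.cong) (auto simp: power2_eq_square algebra_simps)
  also have "\<dots> = (\<Sum>j\<in>J. p j * (x j)\<^sup>2) - 2 * a * (\<Sum>j\<in>J. p j * x j) + a\<^sup>2 * sum p J"
    by (simp add: sum.distrib sum_subtractf sum_distrib_left)
  also have "\<dots> = (\<Sum>j\<in>J. p j * (x j)\<^sup>2) - (\<Sum>j\<in>J. p j * x j)\<^sup>2 / sum p J
      + sum p J * (a - (\<Sum>j\<in>J. p j * x j) / sum p J)\<^sup>2"
  proof -
    have "q - 2 * a * s + a\<^sup>2 * P = q - s\<^sup>2 / P + P * (a - s / P)\<^sup>2" if "P \<noteq> 0" for q s P :: real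
      using that by (simp add: power2_eq_square field_simps)
    then show ?thesis using assms by blast
  qed
  finally show ?thesis .
qed

text \<open>With \<open>u\<close> and \<open>v\<close> the first moments of the two groups, the last
  quotient is the between-group variance. It uses only the lower group and the total mean, a form
  that extends to the two end indices.\<close>

lemma between_variance_eq:
  fixes P Q u v q :: real
  assumes "0 < P" "0 < Q" "P + Q = 1"
  shows "q - u\<^sup>2 / P - v\<^sup>2 / Q
    = q - (u + v)\<^sup>2 - (P * (u + v) - u)\<^sup>2 / (P * (1 - P))"
proof -
  have Q: "Q = 1 - P" and "1 - P \<noteq> 0" using assms by auto
  then show ?thesis using assms(1) unfolding Q
    by (simp add: divide_simps) (simp add: power2_eq_square algebra_simps)
qed

text \<open>At \<open>i = 0\<close> and \<open>i = n\<close> the denominator vanishes, so the last term is \<open>0\<close> there.\<close>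

lemma cut_risk_eq:
  assumes M: "prob_space M" and X: "X \<in> borel_measurable M"
    and law: "\<And>i. i \<in> {1..n} \<Longrightarrow> \<P>(\<omega> in M. X \<omega> = x i) = p i"
    and p: "\<And>i. i \<in> {1..n} \<Longrightarrow> 0 < p i" and sum: "(\<Sum>i\<in>{1..n}. p i) = 1"
    and inj: "inj_on x {1..n}" and "i \<le> n"
  shows "cut_risk M X x p n i = (\<Sum>j\<in>{1..n}. p j * (x j)\<^sup>2) - (\<Sum>j\<in>{1..n}. p j * x j)\<^sup>2
    - (lower_mass p i * (\<Sum>j\<in>{1..n}. p j * x j) - (\<Sum>j\<in>{1..i}. p j * x j))\<^sup>2
      / (lower_mass p i * (1 - lower_mass p i))"
proof (cases "1 \<le> i \<and> i < n")
  case False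
  interpret prob_space M by (rule M)
  let ?m = "\<Sum>j\<in>{1..n}. p j * x j"
  have m: "expectation X = ?m"
    using expectation_finite_law[OF X _ inj law sum, of "\<lambda>t. t"] by simp
  have "variance X = (\<Sum>j\<in>{1..n}. p j * (x j - ?m)\<^sup>2)"
    unfolding m using expectation_finite_law[OF X _ inj law sum, of "\<lambda>t. (t - ?m)\<^sup>2"] by simp
  also have "\<dots> = (\<Sum>j\<in>{1..n}. p j * (x j)\<^sup>2) - ?m\<^sup>2"
    using sum_weighted_square_shift[of p "{1..n}" x ?m] sum by simp
  finally show ?thesis
    using False \<open>i \<le> n\<close> sum by (cases "i = 0") (auto simp: cut_risk_def lower_mass_def)
next
  case True
  let ?P = "sum p {1..i}" and ?Q = "sum p {i<..n}"
  let ?u = "\<Sum>j\<in>{1..i}. p j * x j" and ?v = "\<Sum>j\<in>{i<..n}. p j * x j"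
  let ?f = "\<lambda>a b. (\<Sum>j\<in>{1..i}. p j * (x j - a)\<^sup>2) + (\<Sum>j\<in>{i<..n}. p j * (x j - b)\<^sup>2)"
  have split: "sum g {1..n} = sum g {1..i} + sum g {i<..n}" for g :: "nat \<Rightarrow> real"
    using True by (subst sum.union_disjoint[symmetric]) (auto intro: sum.cong)
  have P: "0 < ?P" and Q: "0 < ?Q" using True p by (auto intro!: sum_pos)
  have f: "?f a b = (\<Sum>j\<in>{1..n}. p j * (x j)\<^sup>2) - ?u\<^sup>2 / ?P - ?v\<^sup>2 / ?Q
      + ?P * (a - ?u / ?P)\<^sup>2 + ?Q * (b - ?v / ?Q)\<^sup>2" for a b
    unfolding split using P Q by (simp add: sum_weighted_square_shift)
  have "cut_risk M X x p n i = (LEAST v. \<exists>a b. v = ?f a b)"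
    using True by (simp add: cut_risk_def)
  also have "\<dots> = (\<Sum>j\<in>{1..n}. p j * (x j)\<^sup>2) - ?u\<^sup>2 / ?P - ?v\<^sup>2 / ?Q"
  proof (rule Least_equality)
    \<comment> \<open>The witnesses are the two group means, which make both squares in
      \<open>f\<close> vanish.\<close>
    show "\<exists>a b. (\<Sum>j\<in>{1..n}. p j * (x j)\<^sup>2) - ?u\<^sup>2 / ?P - ?v\<^sup>2 / ?Q = ?f a b"
      unfolding f by (rule exI[of _ "?u / ?P"], rule exI[of _ "?v / ?Q"]) simp
  next
    fix y assume "\<exists>a b. y = ?f a b"
    then obtain a b where y: "y = ?f a b" by blast
    have "0 \<le> ?P * (a - ?u / ?P)\<^sup>2" "0 \<le> ?Q * (b - ?v / ?Q)\<^sup>2" using P Q by simp_all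
    then show "(\<Sum>j\<in>{1..n}. p j * (x j)\<^sup>2) - ?u\<^sup>2 / ?P - ?v\<^sup>2 / ?Q \<le> y"
      unfolding y f by linarith
  qed
  also have "\<dots> = (\<Sum>j\<in>{1..n}. p j * (x j)\<^sup>2) - (?u + ?v)\<^sup>2
      - (?P * (?u + ?v) - ?u)\<^sup>2 / (?P * (1 - ?P))"
    using P Q sum split[of p] by (intro between_variance_eq) auto
  finally show ?thesis by (simp only: lower_mass_def split)
qed

text \<open>For weight \<open>r\<close> the quotient expands with cross term
  \<open>2 * A * C\<close>, independent of \<open>r\<close>, so it cancels in the difference. The
  remaining differences of reciprocals each contain the factor \<open>P - q\<close>.\<close>

lemma between_variance_diff:
  fixes q P A C :: real
  assumes "0 < q" "q < P" "P < 1"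
  shows "(P * A + (1 - P) * C)\<^sup>2 / (P * (1 - P)) - (q * A + (1 - q) * C)\<^sup>2 / (q * (1 - q))
    = (P - q) * (A\<^sup>2 / ((1 - q) * (1 - P)) - C\<^sup>2 / (q * P))"
proof -
  have expand: "(r * A + (1 - r) * C)\<^sup>2 / (r * (1 - r))
      = A\<^sup>2 * (1 / (1 - r) - 1) + 2 * A * C + C\<^sup>2 * (1 / r - 1)" if "0 < r" "r < 1" for r
    using that by (simp add: divide_simps) (simp add: power2_eq_square algebra_simps)
  have "1 / (1 - P) - 1 / (1 - q) = (P - q) / ((1 - q) * (1 - P))"
    "1 / q - 1 / P = (P - q) / (q * P)"
    using assms by (auto simp: field_simps)
  then have "A\<^sup>2 * (1 / (1 - P) - 1 / (1 - q)) - C\<^sup>2 * (1 / q - 1 / P)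
      = (P - q) * (A\<^sup>2 / ((1 - q) * (1 - P)) - C\<^sup>2 / (q * P))"
    by (simp add: algebra_simps)
  moreover have "0 < P" "q < 1" using assms by auto
  ultimately show ?thesis
    using expand[of P] expand[of q] assms by (simp add: right_diff_distrib)
qed

text \<open>Both cuts adjacent to \<open>x i\<close> can be described by the excesses above and
  below that one point, which makes their between-group variances comparable.\<close>

lemma cut_risk_slope:
  assumes "prob_space M" "X \<in> borel_measurable M" and n: "2 \<le> n"
    and "\<And>i. i \<in> {1..n} \<Longrightarrow> \<P>(\<omega> in M. X \<omega> = x i) = p i"
    and p: "\<And>i. i \<in> {1..n} \<Longrightarrow> 0 < p i" and sum: "(\<Sum>i\<in>{1..n}. p i) = 1"
    and "inj_on x {1..n}" and i: "i \<in> {1..n}"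
  shows "(cut_risk M X x p n i - cut_risk M X x p n (i - 1)) / p i
    = (left_ratio x p n i)\<^sup>2 - (right_ratio x p n i)\<^sup>2"
proof -
  let ?m = "\<Sum>j\<in>{1..n}. p j * x j" and ?a = "\<lambda>i. \<Sum>j\<in>{1..i}. p j * x j"
  define P q where "P = lower_mass p i" and "q = lower_mass p (i - 1)"
  define A C where "A = upper_excess x p n i" and "C = lower_excess x p i"
  have split: "sum g {1..n} = sum g {1..i} + sum g {i<..n}" for g :: "nat \<Rightarrow> real"
    using i by (subst sum.union_disjoint[symmetric]) (auto intro: sum.cong)
  have last: "sum g {1..i} = sum g {1..i - 1} + g i" for g :: "nat \<Rightarrow> real"
    using i by (cases i) auto
  have Pq: "P = q + p i" unfolding P_def q_def lower_mass_def by (rule last)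
  have Q: "sum p {i<..n} = 1 - P"
    using split[of p] sum by (simp add: P_def lower_mass_def)
  have A: "A = ?m - ?a i - (1 - P) * x i"
    unfolding Q[symmetric] split
    by (simp add: A_def upper_excess_def right_diff_distrib sum_subtractf sum_distrib_right)
  have "{1..<i} = {1..i - 1}" using i by auto
  then have C: "C = q * x i - ?a (i - 1)"
    by (simp add: C_def lower_excess_def q_def lower_mass_def right_diff_distrib
        sum_subtractf sum_distrib_right)
  have a: "?a i = ?a (i - 1) + p i * x i" by (rule last)
  \<comment> \<open>The same \<open>A\<close> and \<open>C\<close> serve for both cuts: the atom
    \<open>x i\<close> has distance \<open>0\<close> from itself and may be counted in either
    group.\<close>
  have d: "P * ?m - ?a i = P * A + (1 - P) * C" "q * ?m - ?a (i - 1) = q * A + (1 - q) * C"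
    unfolding A C a Pq by (simp_all add: algebra_simps)
  have W: "cut_risk M X x p n j = (\<Sum>j\<in>{1..n}. p j * (x j)\<^sup>2) - ?m\<^sup>2
      - (lower_mass p j * ?m - ?a j)\<^sup>2 / (lower_mass p j * (1 - lower_mass p j))" if "j \<le> n" for j
    using cut_risk_eq[of M X n x p j] assms that by blast
  have diff: "cut_risk M X x p n i - cut_risk M X x p n (i - 1)
      = (q * A + (1 - q) * C)\<^sup>2 / (q * (1 - q)) - (P * A + (1 - P) * C)\<^sup>2 / (P * (1 - P))"
  proof -
    have "i \<le> n" "i - 1 \<le> n" using i by auto
    then show ?thesis using W[of i] W[of "i - 1"] d by (simp add: P_def q_def)
  qed
  have T: "upper_mass p n i = 1 - q"
  proof -
    have "sum p {i..n} = p i + sum p {i<..n}" using i by (simp add: sum.head)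
    then show ?thesis
      using split[of p] last[of p] sum by (simp add: upper_mass_def q_def lower_mass_def)
  qed
  have T': "upper_mass p n (i + 1) = 1 - P"
  proof -
    have "{i + 1..n} = {i<..n}" by auto
    then show ?thesis using split[of p] sum by (simp add: upper_mass_def P_def lower_mass_def)
  qed
  have q0: "0 \<le> q" "i > 1 \<Longrightarrow> 0 < q" "i = 1 \<Longrightarrow> q = 0"
  proof -
    have pos: "0 < p j" if "j \<in> {1..i - 1}" for j using p i that by auto
    then show "0 \<le> q" unfolding q_def lower_mass_def by (intro sum_nonneg) (rule less_imp_le)
    show "0 < q" if "i > 1"
      unfolding q_def lower_mass_def using pos that by (intro sum_pos) auto
    show "i = 1 \<Longrightarrow> q = 0" by (simp add: q_def lower_mass_def)
  qed
  have "i < n \<Longrightarrow> 0 < sum p {i<..n}" using p i by (intro sum_pos) auto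
  then have P1: "i < n \<Longrightarrow> P < 1" "i = n \<Longrightarrow> P = 1"
    using split[of p] sum by (auto simp: P_def lower_mass_def)
  have pi: "0 < p i" using p i by auto
  have R: "(right_ratio x p n i)\<^sup>2 = (if i < n then A\<^sup>2 / ((1 - q) * (1 - P)) else 0)"
    using i T T' P1 pi Pq by (auto simp: right_ratio_def A_def power_divide)
  have L: "(left_ratio x p n i)\<^sup>2 = (if i > 1 then C\<^sup>2 / (q * P) else 0)"
  proof -
    have "lower_mass p (i - Suc 0) = q" "lower_mass p i = P" by (simp_all add: P_def q_def)
    then show ?thesis using i q0 pi Pq by (auto simp: left_ratio_def C_def power_divide)
  qed
  \<comment> \<open>At the ends \<open>q = 0\<close> or \<open>P = 1\<close>, so one quotient in
    \<open>diff\<close> is \<open>0\<close> by division by zero and the general identity does not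
    apply; \<open>n \<ge> 2\<close> keeps the two ends apart.\<close>
  consider "i = 1" | "i = n" "i \<noteq> 1" | "1 < i" "i < n" using i by fastforce
  then show ?thesis
  proof cases
    case 1
    then have "q = 0" "P = p i" "C = 0" "i < n" "P < 1"
      using q0 Pq n P1 by (auto simp: C_def lower_excess_def)
    moreover have "(p i * A)\<^sup>2 / (p i * (1 - p i)) = p i * (A\<^sup>2 / (1 - p i))"
      using pi by (simp add: power2_eq_square)
    ultimately have "cut_risk M X x p n i - cut_risk M X x p n (i - 1)
        = p i * (- (right_ratio x p n i)\<^sup>2)"
      using diff R by simp
    then show ?thesis using L 1 pi by simp
  next
    case 2
    then have "P = 1" "1 - q = p i" "A = 0" "i > 1"
      using Pq i P1 by (auto simp: A_def upper_excess_def)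
    moreover have "(p i * C)\<^sup>2 / (q * p i) = p i * (C\<^sup>2 / q)"
      using pi by (simp add: power2_eq_square)
    ultimately have "cut_risk M X x p n i - cut_risk M X x p n (i - 1)
        = p i * (left_ratio x p n i)\<^sup>2"
      using diff L by simp
    then show ?thesis using R 2 pi by simp
  next
    case 3
    have "cut_risk M X x p n i - cut_risk M X x p n (i - 1)
        = p i * (C\<^sup>2 / (q * P) - A\<^sup>2 / ((1 - q) * (1 - P)))"
      using between_variance_diff[of q P A C] diff 3 q0 P1 Pq pi by (simp add: algebra_simps)
    then show ?thesis using R L 3 pi by simp
  qed
qed

section \<open>Minimizers of sequences with strictly increasing slopes\<close>

text \<open>Once a slope is nonnegative, all later ones are positive. Beyond the leftmost minimizer
  \<open>k\<close>, the only step that can be flat is therefore the one to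
  \<open>k + 1\<close>.\<close>

lemma arg_min_strict_mono_slopes:
  fixes f p :: "nat \<Rightarrow> real"
  assumes n: "2 \<le> n" and p: "\<And>i. i \<in> {1..n} \<Longrightarrow> 0 < p i"
    and slopes: "strict_mono_on {1..n} (\<lambda>i. (f i - f (i - 1)) / p i)"
  shows "\<exists>k. {i. is_arg_min f (\<lambda>i. i \<in> {1..<n}) i} = {k}
    \<or> {i. is_arg_min f (\<lambda>i. i \<in> {1..<n}) i} = {k, k + 1}"
proof -
  let ?arg = "is_arg_min f (\<lambda>i. i \<in> {1..<n})"
  define k where "k = (LEAST i. ?arg i)"
  have "\<exists>i\<in>{1..<n}. \<forall>j\<in>{1..<n}. f i \<le> f j"
    using n arg_min_if_finite(1)[of "{1..<n}" f] arg_min_least[of "{1..<n}" _ f]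
    by (intro bexI[of _ "arg_min_on f {1..<n}"] ballI) auto
  then have "\<exists>i. ?arg i" by (auto simp: is_arg_min_linorder)
  then have k: "?arg k" unfolding k_def by (rule LeastI_ex)
  have k_le: "k \<le> j" if "?arg j" for j unfolding k_def using that by (rule Least_le)
  have "j \<le> k + 1" if j: "?arg j" for j
  proof (rule ccontr)
    assume "\<not> j \<le> k + 1"
    then have kj: "k + 2 \<le> j" "j < n" "1 \<le> k"
      using j k by (auto simp: is_arg_min_def)
    \<comment> \<open>Because \<open>k + 2 \<le> j < n\<close>, the index \<open>k + 1\<close> is
      itself an admissible cut.\<close>
    have k1: "f k \<le> f (k + 1)" using k kj by (auto simp: is_arg_min_linorder)
    have inc: "f (i - 1) < f i" if "k + 1 < i" "i \<le> n" for i
    proof -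
      have "0 \<le> (f (k + 1) - f k) / p (k + 1)"
        using k1 p[of "k + 1"] kj by (simp add: divide_nonneg_pos)
      also have "\<dots> < (f i - f (i - 1)) / p i"
        using strict_mono_onD[OF slopes, of "k + 1" i] that by simp
      finally show ?thesis using p[of i] that by (simp add: zero_less_divide_iff)
    qed
    have "strict_mono_on {k + 1..n} f"
    proof (rule strict_mono_on_atLeastAtMost_SucI)
      show "f i < f (Suc i)" if "k + 1 \<le> i" "i < n" for i
        using inc[of "Suc i"] that by simp
    qed
    then have "f (k + 1) < f j"
      by (rule strict_mono_onD) (use kj in auto)
    then show False using k1 j k by (auto simp: is_arg_min_linorder)
  qed
  then have "{i. ?arg i} \<subseteq> {k, k + 1}" using k_le by (fastforce simp: le_Suc_eq intro: antisym)
  then show ?thesis using k by blast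
qed

theorem theorem3p1:
  fixes M :: "'a measure" and X :: "'a \<Rightarrow> real"
    and x p :: "nat \<Rightarrow> real" and n :: nat and h :: real
  assumes "prob_space M" and "X \<in> borel_measurable M"
    and "n \<ge> 2"
    and "\<And>i. i \<in> {1..n} \<Longrightarrow> \<P>(\<omega> in M. X \<omega> = x i) = p i"
    and "\<And>i. i \<in> {1..n} \<Longrightarrow> p i > 0"
    and "(\<Sum>i\<in>{1..n}. p i) = 1"
    and "h > 0"
    and "\<And>i. i \<in> {1..n} \<Longrightarrow> x i = x 1 + (real i - 1) * h"
    and "log_concave_seq (lower_mass p) n"
    and "log_concave_seq (upper_mass p n) n"
  shows "strict_antimono_on {1..n} (right_ratio x p n)
    \<and> strict_mono_on {1..n} (left_ratio x p n)
    \<and> strict_mono_on {1..n} (\<lambda>i. (cut_risk M X x p n i - cut_risk M X x p n (i - 1)) / p i)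
    \<and> (\<exists>k. {i. is_arg_min (cut_risk M X x p n) (\<lambda>i. i \<in> {1..<n}) i} = {k}
         \<or> {i. is_arg_min (cut_risk M X x p n) (\<lambda>i. i \<in> {1..<n}) i} = {k, k + 1})"
proof (intro conjI)
  show R: "strict_antimono_on {1..n} (right_ratio x p n)"
    by (rule right_ratio_strict_antimono[OF assms(8,7,10)])
  show L: "strict_mono_on {1..n} (left_ratio x p n)"
    by (rule left_ratio_strict_mono[OF assms(8,7,9)])
  \<comment> \<open>The signs come from monotonicity and the end values \<open>0\<close>. They are
    needed because the slopes involve squares, which preserve order only on nonnegative
    numbers.\<close>
  have R0: "0 \<le> right_ratio x p n i" if "i \<in> {1..n}" for i
  proof (cases "i = n")
    case False
    then have "right_ratio x p n n < right_ratio x p n i"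
      using monotone_onD[OF R, of i n] that by auto
    then show ?thesis by (simp add: right_ratio_def[of x p n n])
  qed (simp add: right_ratio_def)
  have L0: "0 \<le> left_ratio x p n i" if "i \<in> {1..n}" for i
  proof (cases "i = 1")
    case False
    then have "left_ratio x p n 1 < left_ratio x p n i"
      using strict_mono_onD[OF L, of 1 i] that by auto
    moreover have "left_ratio x p n 1 = 0" by (simp add: left_ratio_def)
    ultimately show ?thesis by linarith
  qed (simp add: left_ratio_def)
  have inj: "inj_on x {1..n}"
  proof (rule inj_onI)
    fix i j assume "i \<in> {1..n}" "j \<in> {1..n}" "x i = x j"
    then show "i = j" using assms(8)[of i] assms(8)[of j] \<open>h > 0\<close> by simp
  qed
  show slopes: "strict_mono_on {1..n}
      (\<lambda>i. (cut_risk M X x p n i - cut_risk M X x p n (i - 1)) / p i)"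
  proof (rule strict_mono_onI)
    fix r s assume rs: "r \<in> {1..n}" "s \<in> {1..n}" "r < s"
    have "(left_ratio x p n r)\<^sup>2 < (left_ratio x p n s)\<^sup>2"
      using strict_mono_onD[OF L rs] L0 rs by (intro power_strict_mono) auto
    moreover have "(right_ratio x p n s)\<^sup>2 < (right_ratio x p n r)\<^sup>2"
      using monotone_onD[OF R rs] R0 rs by (intro power_strict_mono) auto
    ultimately show "(cut_risk M X x p n r - cut_risk M X x p n (r - 1)) / p r
        < (cut_risk M X x p n s - cut_risk M X x p n (s - 1)) / p s"
      using cut_risk_slope[of M X n x p r] cut_risk_slope[of M X n x p s] assms(1-6) inj rs
      by simp
  qed
  show "\<exists>k. {i. is_arg_min (cut_risk M X x p n) (\<lambda>i. i \<in> {1..<n}) i} = {k}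
      \<or> {i. is_arg_min (cut_risk M X x p n) (\<lambda>i. i \<in> {1..<n}) i} = {k, k + 1}"
    using assms(3,5) slopes by (intro arg_min_strict_mono_slopes) auto
qed

end
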